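(* Let $S$ be an $AG^{**}$-groupoid. Then $S$ is a paramedial AG-groupoid, i.e. $(ab)(cd)=(db)(ca)$ for all $a,b,c,d\in S$.
   Context: A groupoid is a set $S$ with a binary operation, written as juxtaposition; no associativity or commutativity is assumed. An AG-groupoid is a groupoid $S$ satisfying the left invertive law $(ab)c=(cb)a$ for all $a,b,c\in S$. An $AG^{**}$-groupoid is an AG-groupoid satisfying $a(bc)=b(ac)$ for all $a,b,c\in S$. A paramedial AG-groupoid is an AG-groupoid satisfying the paramedial law $(ab)(cd)=(db)(ca)$ for all $a,b,c,d\in S$. *)

theory Defs
  imports Main
begin

text \<open>Groupoids here are magmas on an explicit, possibly empty carrier set. The operation is a
  total function on the ambient type, but every law is required on the carrier only.\<close>

locale groupoid =
  fixes S :: "'a set"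
    and mult :: "'a \<Rightarrow> 'a \<Rightarrow> 'a" (infixl "\<cdot>" 70)
  assumes closed: "\<lbrakk>a \<in> S; b \<in> S\<rbrakk> \<Longrightarrow> a \<cdot> b \<in> S"

locale AG_groupoid = groupoid +
  assumes left_invertive: "\<lbrakk>a \<in> S; b \<in> S; c \<in> S\<rbrakk> \<Longrightarrow> (a \<cdot> b) \<cdot> c = (c \<cdot> b) \<cdot> a"

locale AG_star_star_groupoid = AG_groupoid +
  assumes star_star: "\<lbrakk>a \<in> S; b \<in> S; c \<in> S\<rbrakk> \<Longrightarrow> a \<cdot> (b \<cdot> c) = b \<cdot> (a \<cdot> c)"

locale paramedial_AG_groupoid = AG_groupoid +
  assumes paramedial:
    "\<lbrakk>a \<in> S; b \<in> S; c \<in> S; d \<in> S\<rbrakk> \<Longrightarrow> (a \<cdot> b) \<cdot> (c \<cdot> d) = (d \<cdot> b) \<cdot> (c \<cdot> a)"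

end

theory Submission
  imports Defs
begin

text \<open>The paramedial law swaps the outer letters \<open>a\<close> and \<open>d\<close>. The
  law \<open>star_star\<close> pulls \<open>c\<close> out in front of \<open>(ab)d\<close>, where
  \<open>left_invertive\<close> exchanges \<open>a\<close> and \<open>d\<close>; a second use of
  \<open>star_star\<close> puts \<open>c\<close> back, now next to \<open>a\<close>.\<close>

theorem lemma14:
  fixes S :: "'a set" and mult :: "'a \<Rightarrow> 'a \<Rightarrow> 'a"
  assumes "AG_star_star_groupoid S mult"
  shows "paramedial_AG_groupoid S mult"
proof -
  interpret AG_star_star_groupoid S mult by fact
  show ?thesis
  \<comment> \<open>The interpretation already supplies the AG-groupoid axioms, so only the
    paramedial law is left to show.\<close>
  proof
    fix a b c d
    assume S: "a \<in> S" "b \<in> S" "c \<in> S" "d \<in> S"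
    have "mult (mult a b) (mult c d) = mult c (mult (mult a b) d)"
      using S by (intro star_star closed)
    also have "mult (mult a b) d = mult (mult d b) a"
      using S by (intro left_invertive)
    also have "mult c (mult (mult d b) a) = mult (mult d b) (mult c a)"
      using S by (intro star_star closed)
    finally show "mult (mult a b) (mult c d) = mult (mult d b) (mult c a)" .
  qed
qed

end
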